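(* Let $n,k\ge 0$ be integers with $k\equiv n\pmod 2$. Then $$c(n,k,q)=\sum_{m\in M(n,k)}q^{\mathrm{c}(m)+\mathrm{cr}(m)}$$ satisfies $$c(n,k,q)=(1-q)^{-\frac{n-k}{2}}\sum_{j\ge 0}\binom{n}{\frac{n-k-2j}{2}}(-1)^jq^{\binom{j}{2}}\frac{[k+2j]}{[k+j]}{k+j\brack j}$$ and $$c(n,k,q)=(1-q)^{-\frac{n-k}{2}}\sum_{j\ge 0}\left(\binom{n}{\frac{n-k-2j}{2}}-\binom{n}{\frac{n-k-2j-2}{2}}\right)(-1)^jq^{\binom{j+1}{2}}{k+j\brack k}.$$
   Context: $q$ is an indeterminate and $[n]=[n]_q=\frac{1-q^n}{1-q}$. The $q$-binomial coefficient is ${n\brack k}=\frac{(q;q)_n}{(q;q)_k(q;q)_{n-k}}$ for $0\le k\le n$ and $0$ otherwise, where $(a;q)_n=\prod_{i=0}^{n-1}(1-aq^i)$. Ordinary binomials $\binom{n}{r}$ are $0$ for $r<0$. When $k=j=0$, the factor $\frac{[k+2j]}{[k+j]}$ is interpreted as $1$. A matching $m$ of $\{1,\dots,n\}$ is a set of pairwise disjoint pairs $(i,j)$, called edges, with $i<j$ and $i,j\in\{1,\dots,n\}$. Elements in no edge are unmatched vertices. $M(n,k)$ is the set of matchings of $\{1,\dots,n\}$ with exactly $k$ unmatched vertices. Two edges $(i,j)$ and $(k,l)$ cross if $i<k<j<l$ or $k<i<l<j$, and $\mathrm{cr}(m)$ is the number of (unordered) pairs of crossing edges of $m$. Finally $\mathrm{c}(m)=\sum_{a}|\{\text{edges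 }(i,j)\text{ of }m:\ i<a<j\}|$, the sum running over all unmatched vertices $a$ of $m$. *)

theory Defs
  imports
    "HOL-Computational_Algebra.Computational_Algebra"
    "HOL-Library.Groups_Big_Fun"
begin

section \<open>Matchings\<close>

text \<open>An edge is a pair \<open>(i, j)\<close> with \<open>i < j\<close>; a matching is identified with its set of edges.\<close>

type_synonym edge = "nat \<times> nat"

definition matching :: "nat \<Rightarrow> edge set \<Rightarrow> bool" where
  "matching n m \<longleftrightarrow>
     (\<forall>(i, j)\<in>m. i \<in> {1..n} \<and> j \<in> {1..n} \<and> i < j) \<and>
     (\<forall>e\<in>m. \<forall>f\<in>m. e \<noteq> f \<longrightarrow> {fst e, snd e} \<inter> {fst f, snd f} = {})"

definition unmatched :: "nat \<Rightarrow> edge set \<Rightarrow> nat set" where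
  "unmatched n m = {a \<in> {1..n}. \<forall>(i, j)\<in>m. a \<noteq> i \<and> a \<noteq> j}"

definition matchings :: "nat \<Rightarrow> nat \<Rightarrow> edge set set" where
  "matchings n k = {m. matching n m \<and> card (unmatched n m) = k}"

definition crosses :: "edge \<Rightarrow> edge \<Rightarrow> bool" where
  "crosses e f \<longleftrightarrow>
     (case e of (i, j) \<Rightarrow> case f of (k, l) \<Rightarrow>
        i < k \<and> k < j \<and> j < l \<or> k < i \<and> i < l \<and> l < j)"

text \<open>Crossings are counted as unordered pairs of edges.\<close>

definition cr :: "edge set \<Rightarrow> nat" where
  "cr m = card {{e, f} | e f. e \<in> m \<and> f \<in> m \<and> crosses e f}"

definition cov :: "nat \<Rightarrow> edge set \<Rightarrow> nat" where
  "cov n m = (\<Sum>a\<in>unmatched n m. card {(i, j) \<in> m. i < a \<and> a < j})"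

definition c :: "nat \<Rightarrow> nat \<Rightarrow> 'a::comm_semiring_1 \<Rightarrow> 'a" where
  "c n k q = (\<Sum>m\<in>matchings n k. q ^ (cov n m + cr m))"


section \<open>Binomials and their \<open>q\<close>-analogues\<close>

text \<open>Binomial coefficient with integer lower index, vanishing for negative ones.\<close>

definition ibinom :: "nat \<Rightarrow> int \<Rightarrow> nat" where
  "ibinom n r = (if r < 0 then 0 else n choose nat r)"

definition qint :: "'a::field \<Rightarrow> nat \<Rightarrow> 'a" where
  "qint q n = (1 - q ^ n) / (1 - q)"

definition qpoch :: "'a::comm_ring_1 \<Rightarrow> 'a \<Rightarrow> nat \<Rightarrow> 'a" where
  "qpoch a q n = (\<Prod>i<n. 1 - a * q ^ i)"

definition qbinom :: "'a::field \<Rightarrow> nat \<Rightarrow> nat \<Rightarrow> 'a" where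
  "qbinom q n k = (if k \<le> n then qpoch q q n / (qpoch q q k * qpoch q q (n - k)) else 0)"

text \<open>The quotient \<open>[k + 2j] / [k + j]\<close>, with the convention that it is \<open>1\<close> when \<open>k = j = 0\<close>.\<close>

definition qint_ratio :: "'a::field \<Rightarrow> nat \<Rightarrow> nat \<Rightarrow> 'a" where
  "qint_ratio q k j = (if k = 0 \<and> j = 0 then 1 else qint q (k + 2 * j) / qint q (k + j))"


section \<open>The indeterminate\<close>

text \<open>
  The variable of the field of rational functions over the rationals. The quotients above
  are thus genuine: no \<open>1 - q ^ n\<close> with \<open>n > 0\<close> vanishes.
\<close>

definition qvar :: "rat poly fract" where
  "qvar = Fract [:0, 1:] 1"


section \<open>Sums over all natural numbers\<close>

text \<open>
  A sum over all \<open>j \<ge> 0\<close> with finitely many non-zero terms is expressed by \<^const>\<open>Sum_any\<close>,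
  which is the sum over the support and would collapse to \<open>0\<close> if the support were infinite.
  The following lemmas show that this does not happen for the sums in question.
\<close>

lemma finite_support_ibinom:
  fixes f :: "nat \<Rightarrow> 'a::ring_1"
  shows "finite {j. of_nat (ibinom n ((int n - int k - 2 * int j) div 2)) * f j \<noteq> 0}"
proof (rule finite_subset)
  show "{j. of_nat (ibinom n ((int n - int k - 2 * int j) div 2)) * f j \<noteq> 0} \<subseteq> {..n}"
    by (auto simp: ibinom_def split: if_splits)
qed simp

lemma finite_support_ibinom_diff:
  fixes f :: "nat \<Rightarrow> 'a::ring_1"
  shows "finite {j. (of_nat (ibinom n ((int n - int k - 2 * int j) div 2)) -
      of_nat (ibinom n ((int n - int k - 2 * int j - 2) div 2))) * f j \<noteq> 0}"
proof (rule finite_subset)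
  show "{j. (of_nat (ibinom n ((int n - int k - 2 * int j) div 2)) -
      of_nat (ibinom n ((int n - int k - 2 * int j - 2) div 2))) * f j \<noteq> 0} \<subseteq> {..n}"
    by (auto simp: ibinom_def split: if_splits)
qed simp

end

theory Submission
  imports Defs
begin

text \<open>
  Deleting the last vertex of a matching gives a recurrence in \<open>n\<close>. If \<open>n + 1\<close> is unmatched, no
  edge covers it and the weight is unchanged. If it is matched with \<open>i\<close>, then deleting it frees
  \<open>i\<close>: the edges that crossed \<open>(i, n + 1)\<close> are exactly those that cover the new unmatched
  vertex \<open>i\<close>, so crossings turn into coverings, and the only weight lost is one factor \<open>q\<close> for
  every unmatched vertex to the right of \<open>i\<close>. As \<open>i\<close> runs through the \<open>k + 1\<close> unmatched vertices
  of the smaller matching, these losses take each of the values \<open>0, \<dots>, k\<close> once, hence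
  \<open>c (n + 1) k = c n (k - 1) + [k + 1] * c n (k + 1)\<close>. This is lemma \<open>c_Suc\<close>.

  The second formula satisfies the same recurrence. The differences
  \<open>binomial n r - binomial n (r - 1)\<close> obey Pascal's rule, and after comparing coefficients of
  equal differences the recurrence becomes the \<open>q\<close>-Pascal rule for the alternating coefficients
  (\<open>alt_qbinom_rec\<close>). At the boundary \<open>k = 0\<close> a term is left over; it carries the difference of
  the two middle binomial coefficients of an odd row, which is \<open>0\<close>. The first formula is the second one
  after summation by parts, because consecutive differences of the alternating coefficients produce
  the quotient \<open>[k + 2j] / [k + j]\<close> (\<open>alt_qbinom_diff\<close>).

  The algebra works in every field for every \<open>q\<close> that is not a root of unity.
\<close>


section \<open>Deleting the last vertex of a matching\<close>

lemma finite_matching: "matching n m \<Longrightarrow> finite m"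
  by (rule finite_subset[of _ "{1..n} \<times> {1..n}"]) (auto simp: matching_def)

lemma finite_unmatched [simp]: "finite (unmatched n m)"
  by (simp add: unmatched_def)

lemma finite_matchings [simp]: "finite (matchings n k)"
  by (rule finite_subset[of _ "Pow ({1..n} \<times> {1..n})"])
     (auto simp: matchings_def matching_def)

lemma matchings_eq_empty: "n < k \<Longrightarrow> matchings n k = {}"
proof (rule ccontr)
  assume "n < k" "matchings n k \<noteq> {}"
  then obtain m where "card (unmatched n m) = k" by (auto simp: matchings_def)
  moreover have "card (unmatched n m) \<le> card {1..n}"
    by (intro card_mono) (auto simp: unmatched_def)
  ultimately show False using \<open>n < k\<close> by simp
qed

lemma matching_edge: "matching n m \<Longrightarrow> (x, y) \<in> m \<Longrightarrow> 1 \<le> x \<and> x < y \<and> y \<le> n"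
  unfolding matching_def by fastforce

lemma matching_disjoint:
  "matching n m \<Longrightarrow> (x, y) \<in> m \<Longrightarrow> (u, v) \<in> m \<Longrightarrow> (x, y) \<noteq> (u, v) \<Longrightarrow>
    x \<noteq> u \<and> x \<noteq> v \<and> y \<noteq> u \<and> y \<noteq> v"
  unfolding matching_def by fastforce

lemma matchingI:
  assumes "\<And>x y. (x, y) \<in> m \<Longrightarrow> 1 \<le> x \<and> x < y \<and> y \<le> n"
    and "\<And>x y u v. (x, y) \<in> m \<Longrightarrow> (u, v) \<in> m \<Longrightarrow> (x, y) \<noteq> (u, v) \<Longrightarrow>
      x \<noteq> u \<and> x \<noteq> v \<and> y \<noteq> u \<and> y \<noteq> v"
  shows "matching n m"
proof -
  have "{fst e, snd e} \<inter> {fst f, snd f} = {}" if "e \<in> m" "f \<in> m" "e \<noteq> f" for e f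
    using assms(2)[of "fst e" "snd e" "fst f" "snd f"] that by auto
  moreover have "\<forall>(i, j)\<in>m. i \<in> {1..n} \<and> j \<in> {1..n} \<and> i < j"
    using assms(1) by fastforce
  ultimately show ?thesis unfolding matching_def by blast
qed

lemma matching_subset: "matching n m \<Longrightarrow> m' \<subseteq> m \<Longrightarrow> matching n m'"
  unfolding matching_def by blast

lemma matching_Suc: "matching n m \<Longrightarrow> matching (Suc n) m"
  by (rule matchingI; use matching_edge matching_disjoint le_Suc_eq in blast)

lemma matching_Suc_iff_unmatched:
  "matching n m \<longleftrightarrow> matching (Suc n) m \<and> Suc n \<in> unmatched (Suc n) m"
proof
  assume m: "matching n m"
  show "matching (Suc n) m \<and> Suc n \<in> unmatched (Suc n) m"
    using matching_Suc[OF m] matching_edge[OF m] by (fastforce simp: unmatched_def)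
next
  assume m: "matching (Suc n) m \<and> Suc n \<in> unmatched (Suc n) m"
  have *: "1 \<le> x \<and> x < y \<and> y \<le> n" if "(x, y) \<in> m" for x y
  proof -
    have "y \<noteq> Suc n" using m that by (auto simp: unmatched_def)
    then show ?thesis using matching_edge[of "Suc n" m x y] m that by auto
  qed
  show "matching n m"
    by (rule matchingI[OF *]) (use m matching_disjoint in blast)+
qed

lemma unmatched_Suc: "matching n m \<Longrightarrow> unmatched (Suc n) m = insert (Suc n) (unmatched n m)"
  using matching_edge[of n m] by (fastforce simp: unmatched_def le_Suc_eq)

lemma in_unmatched_iff:
  "a \<in> unmatched n m \<longleftrightarrow> 1 \<le> a \<and> a \<le> n \<and> (\<forall>x y. (x, y) \<in> m \<longrightarrow> a \<noteq> x \<and> a \<noteq> y)"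
  by (auto simp: unmatched_def)

lemma Suc_notin_unmatched [simp]: "Suc n \<notin> unmatched n m"
  by (simp add: unmatched_def)

lemma matching_insert_last:
  assumes "matching n m" "i \<in> unmatched n m"
  shows "matching (Suc n) (insert (i, Suc n) m)"
proof (rule matchingI)
  have i: "1 \<le> i" "i \<le> n" "\<And>x y. (x, y) \<in> m \<Longrightarrow> i \<noteq> x \<and> i \<noteq> y"
    using assms(2) by (auto simp: unmatched_def)
  fix x y assume xy: "(x, y) \<in> insert (i, Suc n) m"
  show "1 \<le> x \<and> x < y \<and> y \<le> Suc n"
    using xy i matching_edge[OF assms(1), of x y] by auto
  fix u v assume uv: "(u, v) \<in> insert (i, Suc n) m" "(x, y) \<noteq> (u, v)"
  show "x \<noteq> u \<and> x \<noteq> v \<and> y \<noteq> u \<and> y \<noteq> v"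
    using xy uv i matching_edge[OF assms(1), of x y] matching_edge[OF assms(1), of u v]
      matching_disjoint[OF assms(1), of x y u v] by auto
qed

lemma unmatched_insert_last:
  "matching n m \<Longrightarrow> i \<in> unmatched n m \<Longrightarrow>
    unmatched (Suc n) (insert (i, Suc n) m) = unmatched n m - {i}"
  using matching_edge[of n m] by (fastforce simp: unmatched_def le_Suc_eq)

lemma obtain_matching_insert_last:
  assumes m: "matching (Suc n) m" and last: "Suc n \<notin> unmatched (Suc n) m"
  obtains i m' where "matching n m'" "i \<in> unmatched n m'" "m = insert (i, Suc n) m'"
proof -
  from last obtain x y where xy: "(x, y) \<in> m" "Suc n = x \<or> Suc n = y"
    by (auto simp: unmatched_def)
  then have y: "y = Suc n" using matching_edge[OF m xy(1)] by auto
  define m' where "m' = m - {(x, y)}"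
  have *: "u \<noteq> x \<and> u \<noteq> y \<and> v \<noteq> x \<and> v \<noteq> y" if "(u, v) \<in> m'" for u v
    using matching_disjoint[OF m xy(1), of u v] that by (auto simp: m'_def)
  have "matching (Suc n) m'" using matching_subset[OF m, of m'] by (auto simp: m'_def)
  moreover have "Suc n \<in> unmatched (Suc n) m'"
    unfolding in_unmatched_iff using * y by (metis le_add1 plus_1_eq_Suc order_refl)
  ultimately have m': "matching n m'" using matching_Suc_iff_unmatched by blast
  have "x \<in> unmatched n m'"
    unfolding in_unmatched_iff using * matching_edge[OF m xy(1)] y by (metis less_Suc_eq_le)
  moreover have "m = insert (x, Suc n) m'" using xy y by (auto simp: m'_def)
  ultimately show thesis using m' that by blast
qed

text \<open>The two summands correspond to the last vertex being unmatched and being matched.\<close>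

lemma matchings_Suc:
  "matchings (Suc n) k =
    {m. matching n m \<and> Suc (card (unmatched n m)) = k} \<union>
    (\<lambda>(m, i). insert (i, Suc n) m) ` (SIGMA m:matchings n (Suc k). unmatched n m)"
proof (intro set_eqI iffI)
  fix m assume "m \<in> matchings (Suc n) k"
  then have m: "matching (Suc n) m" "card (unmatched (Suc n) m) = k"
    by (auto simp: matchings_def)
  show "m \<in> {m. matching n m \<and> Suc (card (unmatched n m)) = k} \<union>
    (\<lambda>(m, i). insert (i, Suc n) m) ` (SIGMA m:matchings n (Suc k). unmatched n m)"
  proof (cases "Suc n \<in> unmatched (Suc n) m")
    case True
    then have "matching n m" using m matching_Suc_iff_unmatched by blast
    then show ?thesis using m by (simp add: unmatched_Suc)
  next
    case False
    from obtain_matching_insert_last[OF m(1) this] obtain i m'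
      where *: "matching n m'" "i \<in> unmatched n m'" "m = insert (i, Suc n) m'" .
    then have "k = card (unmatched n m' - {i})" using m unmatched_insert_last by metis
    then have "card (unmatched n m') = Suc k"
      using * by (metis card.remove finite_unmatched)
    then show ?thesis using * by (auto simp: matchings_def intro!: image_eqI[of _ _ "(m', i)"])
  qed
next
  fix m assume "m \<in> {m. matching n m \<and> Suc (card (unmatched n m)) = k} \<union>
    (\<lambda>(m, i). insert (i, Suc n) m) ` (SIGMA m:matchings n (Suc k). unmatched n m)"
  then show "m \<in> matchings (Suc n) k"
    by (auto simp: matchings_def unmatched_Suc matching_Suc unmatched_insert_last
        matching_insert_last)
qed

lemma inj_on_insert_last:
  "inj_on (\<lambda>(m, i). insert (i, Suc n) m) (SIGMA m:matchings n k. unmatched n m)"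
proof (rule inj_onI, clarsimp)
  fix m i m' i'
  assume "m \<in> matchings n k" "m' \<in> matchings n k"
    and eq: "insert (i, Suc n) m = insert (i', Suc n) m'"
  then have "(x, Suc n) \<notin> m" "(x, Suc n) \<notin> m'" for x
    using matching_edge[of n _ x "Suc n"] by (auto simp: matchings_def)
  with eq show "m = m' \<and> i = i'" by (metis insert_ident insert_iff prod.inject)
qed


section \<open>Change of the weight\<close>

lemma crosses_commute: "crosses e f \<longleftrightarrow> crosses f e"
  by (auto simp: crosses_def split: prod.splits)

lemma not_crosses_self [simp]: "\<not> crosses e e"
  by (auto simp: crosses_def split: prod.splits)

lemma cr_insert:
  assumes "finite m" "e \<notin> m"
  shows "cr (insert e m) = cr m + card {f \<in> m. crosses e f}"
proof -
  let ?S = "\<lambda>m. {{e, f} | e f. e \<in> m \<and> f \<in> m \<and> crosses e f}"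
  let ?T = "(\<lambda>f. {e, f}) ` {f \<in> m. crosses e f}"
  have "?S (insert e m) = ?S m \<union> ?T"
  proof (intro equalityI subsetI)
    fix x assume "x \<in> ?S (insert e m)"
    then obtain a b where "x = {a, b}" "a \<in> insert e m" "b \<in> insert e m" "crosses a b" by blast
    moreover from this have "crosses b a" "{a, b} = {b, a}" "a \<noteq> b"
      using crosses_commute by auto
    ultimately show "x \<in> ?S m \<union> ?T" by (elim insertE; blast)
  qed blast
  moreover have "?S m \<inter> ?T = {}" using assms(2) by (auto simp: doubleton_eq_iff)
  moreover have "finite (?S m)"
    by (rule finite_subset[of _ "Pow m"]) (use assms in auto)
  moreover have "inj_on (\<lambda>f. {e, f}) {f \<in> m. crosses e f}"
    by (auto simp: inj_on_def doubleton_eq_iff)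
  ultimately show ?thesis
    using assms(1) by (simp add: cr_def card_Un_disjoint card_image)
qed

lemma cov_Suc: "matching n m \<Longrightarrow> cov (Suc n) m = cov n m"
proof -
  assume m: "matching n m"
  have "{(i, j) \<in> m. i < Suc n \<and> Suc n < j} = {}" using matching_edge[OF m] by fastforce
  then have "card {(i, j) \<in> m. i < Suc n \<and> Suc n < j} = 0" by (simp only: card.empty)
  then show ?thesis by (simp add: cov_def unmatched_Suc[OF m])
qed

text \<open>
  The edges of \<open>m\<close> that the new edge crosses are those that cover \<open>i\<close> in \<open>m\<close>. They are counted by
  \<^const>\<open>cr\<close> after the insertion and by \<^const>\<open>cov\<close> before it, and cancel from the balance.
\<close>

lemma weight_insert_last:
  assumes m: "matching n m" and i: "i \<in> unmatched n m"
  shows "cov (Suc n) (insert (i, Suc n) m) + cr (insert (i, Suc n) m) =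
    cov n m + cr m + card {a \<in> unmatched n m. i < a}"
proof -
  let ?U = "unmatched n m" and ?e = "(i, Suc n)"
  let ?C = "\<lambda>m a. {(x, y) \<in> m. x < a \<and> a < y}"
  have fin: "finite m" using m by (rule finite_matching)
  have e: "?e \<notin> m" using matching_edge[OF m, of i "Suc n"] by auto
  have "{f \<in> m. crosses ?e f} = ?C m i"
    using matching_edge[OF m] by (fastforce simp: crosses_def)
  then have cr: "cr (insert ?e m) = cr m + card (?C m i)"
    using cr_insert[OF fin e] by simp
  have C: "card (?C (insert ?e m) a) = card (?C m a) + (if i < a then 1 else 0)"
    if "a \<in> ?U" for a
  proof -
    have "a < Suc n" using that by (auto simp: unmatched_def)
    then have "?C (insert ?e m) a = (if i < a then insert ?e (?C m a) else ?C m a)" by auto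
    moreover have "finite (?C m a)" by (rule finite_subset[OF _ fin]) auto
    ultimately show ?thesis using e by simp
  qed
  have "cov (Suc n) (insert ?e m) = (\<Sum>a\<in>?U - {i}. card (?C m a) + (if i < a then 1 else 0))"
    unfolding cov_def unmatched_insert_last[OF m i] by (intro sum.cong refl C) simp
  also have "\<dots> = (\<Sum>a\<in>?U - {i}. card (?C m a)) + (\<Sum>a\<in>?U - {i}. if i < a then 1 else 0)"
    by (rule sum.distrib)
  also have "(\<Sum>a\<in>?U - {i}. if i < a then 1 else 0) = card {a \<in> ?U. i < a}"
    by (subst sum.inter_filter[symmetric]) (auto intro!: arg_cong[where f = card])
  finally have "cov (Suc n) (insert ?e m) + card (?C m i) = cov n m + card {a \<in> ?U. i < a}"
    using i by (simp add: cov_def sum.remove[of ?U i])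
  with cr show ?thesis by simp
qed

lemma sum_power_card_greater:
  fixes A :: "'a::linorder set" and q :: "'b::comm_semiring_1"
  assumes "finite A"
  shows "(\<Sum>i\<in>A. q ^ card {a \<in> A. i < a}) = (\<Sum>i<card A. q ^ i)"
  using assms
proof (induction A rule: finite_linorder_min_induct)
  case empty
  then show ?case by simp
next
  case (insert b A)
  have "{a \<in> insert b A. i < a} = (if i = b then A else {a \<in> A. i < a})" if "i \<in> insert b A" for i
    using that insert.hyps(2) by auto
  then have "(\<Sum>i\<in>insert b A. q ^ card {a \<in> insert b A. i < a}) =
      (\<Sum>i\<in>insert b A. q ^ card (if i = b then A else {a \<in> A. i < a}))"
    by (intro sum.cong) auto
  also have "\<dots> = q ^ card A + (\<Sum>i\<in>A. q ^ card (if i = b then A else {a \<in> A. i < a}))"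
    using insert.hyps by (subst sum.insert) auto
  also have "(\<Sum>i\<in>A. q ^ card (if i = b then A else {a \<in> A. i < a})) =
      (\<Sum>i\<in>A. q ^ card {a \<in> A. i < a})"
    using insert.hyps by (intro sum.cong) auto
  finally show ?case using insert by (auto simp: add.commute)
qed

lemma c_eq_0: "n < k \<Longrightarrow> c n k q = 0"
  by (simp add: c_def matchings_eq_empty)

lemma c_0_0: "c 0 0 q = 1"
proof -
  have "matchings 0 0 = {{}}"
    by (auto simp: matchings_def matching_def unmatched_def)
  then show ?thesis by (simp add: c_def cov_def cr_def unmatched_def)
qed

text \<open>
  The choices of \<open>i\<close> in a fixed matching contribute a geometric sum, since \<open>i\<close> loses as many factors
  \<open>q\<close> as there are unmatched vertices to its right.
\<close>

lemma c_Suc: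
  "c (Suc n) k q =
    (case k of 0 \<Rightarrow> 0 | Suc k' \<Rightarrow> c n k' q) + (\<Sum>i<Suc k. q ^ i) * c n (Suc k) q"
proof -
  let ?w = "\<lambda>n m. q ^ (cov n m + cr m)"
  let ?A = "{m. matching n m \<and> Suc (card (unmatched n m)) = k}"
  let ?S = "SIGMA m:matchings n (Suc k). unmatched n m"
  let ?ins = "\<lambda>(m, i). insert (i, Suc n) m"
  have A: "?A = (case k of 0 \<Rightarrow> {} | Suc k' \<Rightarrow> matchings n k')"
    by (auto simp: matchings_def split: nat.splits)
  have finA: "finite ?A" unfolding A by (auto split: nat.splits)
  have disj: "?A \<inter> ?ins ` ?S = {}"
    using matching_edge[of n _ _ "Suc n"] by fastforce
  have "c (Suc n) k q = sum (?w (Suc n)) ?A + sum (?w (Suc n)) (?ins ` ?S)"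
    unfolding c_def matchings_Suc using finA disj by (intro sum.union_disjoint) auto
  also have "sum (?w (Suc n)) ?A = sum (?w n) ?A"
    by (intro sum.cong) (auto simp: cov_Suc)
  also have "\<dots> = (case k of 0 \<Rightarrow> 0 | Suc k' \<Rightarrow> c n k' q)"
    unfolding A by (auto simp: c_def split: nat.splits)
  also have "sum (?w (Suc n)) (?ins ` ?S) = (\<Sum>p\<in>?S. ?w (Suc n) (?ins p))"
    by (rule sum.reindex[OF inj_on_insert_last, unfolded comp_def])
  also have "\<dots> = (\<Sum>(m, i)\<in>?S. ?w n m * q ^ card {a \<in> unmatched n m. i < a})"
    by (intro sum.cong) (auto simp: matchings_def weight_insert_last simp flip: power_add)
  also have "\<dots> = (\<Sum>m\<in>matchings n (Suc k). \<Sum>i\<in>unmatched n m.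
      ?w n m * q ^ card {a \<in> unmatched n m. i < a})"
    by (rule sum.Sigma[symmetric]) auto
  also have "\<dots> = (\<Sum>m\<in>matchings n (Suc k). ?w n m * (\<Sum>i<Suc k. q ^ i))"
    by (intro sum.cong refl, subst sum_distrib_left[symmetric], subst sum_power_card_greater)
       (auto simp: matchings_def)
  also have "\<dots> = (\<Sum>i<Suc k. q ^ i) * c n (Suc k) q"
    unfolding c_def by (subst sum_distrib_right[symmetric]) (rule mult.commute)
  finally show ?thesis .
qed


section \<open>Differences of binomial coefficients\<close>

text \<open>
  For \<open>0 \<le> 2 r \<le> n + 1\<close> these are the ballot numbers. The index is an integer so that Pascal's rule
  holds without exceptions.
\<close>

definition binom_diff :: "nat \<Rightarrow> int \<Rightarrow> 'a::ring_1" where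
  "binom_diff n r = of_nat (ibinom n r) - of_nat (ibinom n (r - 1))"

lemma ibinom_Suc: "ibinom (Suc n) r = ibinom n r + ibinom n (r - 1)"
proof (cases "r \<le> 0")
  case True
  then show ?thesis by (cases "r = 0") (auto simp: ibinom_def)
next
  case False
  then obtain s where "r = int (Suc s)" by (metis not_le pos_int_cases gr0_implies_Suc)
  then show ?thesis by (simp add: ibinom_def nat_add_distrib)
qed

lemma binom_diff_Suc: "binom_diff (Suc n) r = binom_diff n r + binom_diff n (r - 1)"
  by (simp add: binom_diff_def ibinom_Suc)

lemma binom_diff_neg [simp]: "r < 0 \<Longrightarrow> binom_diff n r = 0"
  by (simp add: binom_diff_def ibinom_def)

lemma binom_diff_middle: "binom_diff (Suc (2 * l)) (int (Suc l)) = 0"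
proof -
  have "Suc (2 * l) choose Suc l = Suc (2 * l) choose l"
    by (subst binomial_symmetric) auto
  then show ?thesis by (simp add: binom_diff_def ibinom_def nat_add_distrib)
qed


section \<open>The alternating coefficients\<close>

definition alt_qbinom :: "'a::field \<Rightarrow> nat \<Rightarrow> nat \<Rightarrow> 'a" where
  "alt_qbinom q k j = (-1) ^ j * q ^ ((j + 1) choose 2) * qbinom q (k + j) k"

lemma Suc_choose_two: "Suc j choose 2 = (j choose 2) + j"
  by (simp add: numeral_2_eq_2)

lemma qpoch_Suc: "qpoch q q (Suc n) = qpoch q q n * (1 - q ^ Suc n)"
  by (simp add: qpoch_def)

lemma qbinom_add: "qbinom q (k + j) k = qpoch q q (k + j) / (qpoch q q k * qpoch q q j)"
  by (simp add: qbinom_def)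

text \<open>
  Summation by parts. The case \<open>s = 1\<close> is for Pascal's rule, the case \<open>s = - 1\<close> for differences.
\<close>

lemma sum_shift_by_parts:
  fixes g b :: "nat \<Rightarrow> 'a::comm_ring_1"
  assumes "g (Suc N) = 0"
  shows "(\<Sum>j\<le>N. (g j + s * g (Suc j)) * b j) =
    g 0 * b 0 + (\<Sum>j<N. g (Suc j) * (b (Suc j) + s * b j))"
proof -
  have "(\<Sum>j\<le>N. (g j + s * g (Suc j)) * b j) =
      g 0 * b 0 + (\<Sum>j<N. g (Suc j) * (b (Suc j) + s * b j)) + s * g (Suc N) * b N"
    by (induction N) (auto simp: algebra_simps)
  with assms show ?thesis by simp
qed

locale not_root_of_unity =
  fixes q :: "'a::field"
  assumes power_neq_1: "\<And>n. n > 0 \<Longrightarrow> q ^ n \<noteq> 1"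
begin

lemma qpoch_nonzero [simp]: "qpoch q q n \<noteq> 0"
proof -
  have "1 - q * q ^ i \<noteq> 0" for i using power_neq_1[of "Suc i"] by auto
  then show ?thesis unfolding qpoch_def by simp
qed

lemma one_minus_power_nonzero: "1 - q ^ Suc n \<noteq> 0"
  using power_neq_1[of "Suc n"] by auto

lemma one_minus_nonzero: "1 - q \<noteq> 0"
  using one_minus_power_nonzero[of 0] by simp

lemma qbinom_Pascal:
  "qbinom q (Suc k + Suc j) (Suc k) =
    qbinom q (Suc k + j) (Suc k) + q ^ Suc j * qbinom q (k + Suc j) k"
proof -
  define a b where "a = 1 - q ^ Suc k" and "b = 1 - q ^ Suc j"
  define K where "K = qpoch q q (Suc (k + j))"
  have nz: "a \<noteq> 0" "b \<noteq> 0"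
    using one_minus_power_nonzero by (simp_all only: a_def b_def not_False_eq_True)
  have "1 - q ^ Suc (Suc (k + j)) = b + q ^ Suc j * a"
    by (simp add: a_def b_def power_add algebra_simps)
  then have "qbinom q (Suc k + Suc j) (Suc k) =
      K * (b + q ^ Suc j * a) / ((qpoch q q k * a) * (qpoch q q j * b))"
    unfolding qbinom_add by (simp add: qpoch_Suc a_def b_def K_def del: power_Suc)
  also have "\<dots> = K / ((qpoch q q k * a) * qpoch q q j) +
      q ^ Suc j * (K / (qpoch q q k * (qpoch q q j * b)))"
    using nz by (simp add: field_simps)
  finally show ?thesis
    unfolding qbinom_add by (simp add: qpoch_Suc a_def b_def K_def del: power_Suc)
qed

lemma qbinom_absorb:
  "(1 - q ^ Suc k) * qbinom q (Suc k + j) (Suc k) = (1 - q ^ Suc j) * qbinom q (k + Suc j) k"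
proof -
  define x y where "x = q ^ k" and "y = q ^ j"
  have "1 - q * x \<noteq> 0" "1 - q * y \<noteq> 0"
    using one_minus_power_nonzero[of k] one_minus_power_nonzero[of j] by (auto simp: x_def y_def)
  then show ?thesis
    unfolding qbinom_add
    by (simp add: qpoch_Suc power_add flip: x_def y_def)
qed

lemma alt_qbinom_right_0 [simp]: "alt_qbinom q k 0 = 1"
  using qbinom_add[of q k 0] by (simp add: alt_qbinom_def numeral_2_eq_2) (simp add: qpoch_def)

lemma qbinom_left_0: "qbinom q j 0 = 1"
  by (simp add: qbinom_def) (simp add: qpoch_def)

text \<open>
  Absorption trades the last product for \<open>1 - q ^ (j + 1)\<close> times the \<open>q\<close>-binomial coefficient of
  the first summand. The two multiples of \<open>q ^ (j + 1)\<close> then cancel, and what remains is the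
  \<open>q\<close>-Pascal rule.
\<close>

lemma alt_qbinom_rec:
  "alt_qbinom q (Suc k) (Suc j) + alt_qbinom q (Suc k) j =
    alt_qbinom q k (Suc j) + (1 - q ^ Suc (Suc k)) * alt_qbinom q (Suc (Suc k)) j"
proof -
  define P where "P = (-1) ^ j * q ^ (Suc j choose 2)"
  let ?B = "\<lambda>k j. qbinom q (k + j) k"
  have b0: "alt_qbinom q k j = P * ?B k j" for k by (simp add: alt_qbinom_def P_def)
  have b1: "alt_qbinom q k (Suc j) = - (P * q ^ Suc j * ?B k (Suc j))" for k
    by (simp add: alt_qbinom_def P_def Suc_choose_two[of "Suc j"] power_add mult_ac)
  have "(1 - q ^ Suc (Suc k)) * alt_qbinom q (Suc (Suc k)) j =
      P * ((1 - q ^ Suc (Suc k)) * ?B (Suc (Suc k)) j)"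
    unfolding b0 by (simp only: mult_ac)
  also have "\<dots> = P * ((1 - q ^ Suc j) * ?B (Suc k) (Suc j))"
    by (simp only: qbinom_absorb)
  finally have rhs: "(1 - q ^ Suc (Suc k)) * alt_qbinom q (Suc (Suc k)) j =
      P * ((1 - q ^ Suc j) * ?B (Suc k) (Suc j))" .
  show ?thesis
    unfolding rhs unfolding b0 b1 qbinom_Pascal by (simp add: algebra_simps)
qed

text \<open>For \<open>k = 0\<close> the term with \<open>k - 1\<close> is absent from the recurrence.\<close>

lemma alt_qbinom_rec_0:
  "alt_qbinom q 0 (Suc j) + alt_qbinom q 0 j = (1 - q) * alt_qbinom q (Suc 0) j"
proof -
  have "(1 - q) * qbinom q (Suc j) (Suc 0) = 1 - q * q ^ j"
    using qbinom_absorb[of 0 j] by (simp add: qbinom_left_0)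
  then have "(1 - q) * alt_qbinom q (Suc 0) j = (-1) ^ j * q ^ (Suc j choose 2) * (1 - q * q ^ j)"
    by (simp add: alt_qbinom_def mult_ac)
  then show ?thesis
    by (simp add: alt_qbinom_def qbinom_left_0 Suc_choose_two[of "Suc j"] power_add algebra_simps)
qed

text \<open>
  Both terms on the right are multiples of the same \<open>q\<close>-binomial coefficient divided by
  \<open>[k + j + 1]\<close>, and \<open>q ^ (j + 1) [k + j + 1] + [j + 1] = [k + 2 (j + 1)]\<close>.
\<close>

lemma alt_qbinom_diff:
  "(-1) ^ Suc j * q ^ (Suc j choose 2) * qint_ratio q k (Suc j) * qbinom q (k + Suc j) (Suc j) =
    alt_qbinom q k (Suc j) - alt_qbinom q k j"
proof -
  define P where "P = (-1) ^ j * q ^ (Suc j choose 2)"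
  define x y where "x = q ^ k" and "y = q ^ j"
  have nz: "1 - q * x * y \<noteq> 0" "1 - q * y \<noteq> 0"
    using one_minus_power_nonzero[of "k + j"] one_minus_power_nonzero[of j]
    by (auto simp: x_def y_def power_add mult_ac)
  have B1: "qbinom q (k + Suc j) (Suc j) = qbinom q (k + Suc j) k"
    by (simp add: qbinom_def mult.commute)
  have B2: "qbinom q (k + Suc j) k = qbinom q (k + j) k * (1 - q * x * y) / (1 - q * y)"
    unfolding qbinom_add by (simp add: qpoch_Suc power_add mult_ac flip: x_def y_def)
  have pw: "q ^ (k + 2 * Suc j) = q * q * x * y * y" "q ^ (k + Suc j) = q * x * y"
    by (simp_all add: x_def y_def power_add mult_2 mult_2_right mult_ac)
  have R: "qint_ratio q k (Suc j) = (1 - q * q * x * y * y) / (1 - q * x * y)"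
    unfolding qint_ratio_def qint_def pw using one_minus_nonzero nz by simp
  have b0: "alt_qbinom q k j = P * qbinom q (k + j) k"
    by (simp add: alt_qbinom_def P_def)
  have b1: "alt_qbinom q k (Suc j) = - (P * (q * y) * qbinom q (k + Suc j) k)"
    by (simp add: alt_qbinom_def P_def Suc_choose_two[of "Suc j"] power_add y_def mult_ac)
  have P: "(-1) ^ Suc j * q ^ (Suc j choose 2) = - P" by (simp add: P_def)
  show ?thesis
    unfolding P b0 b1 R B1 B2 using nz by (simp add: divide_simps) (simp add: algebra_simps)
qed


section \<open>The two formulas\<close>

definition alt_sum :: "nat \<Rightarrow> nat \<Rightarrow> int \<Rightarrow> nat \<Rightarrow> 'a" where
  "alt_sum N n r k = (\<Sum>j\<le>N. binom_diff n (r - int j) * alt_qbinom q k j)"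

lemma alt_sum_neg [simp]: "r < 0 \<Longrightarrow> alt_sum N n r k = 0"
  by (simp add: alt_sum_def)

lemma alt_sum_head:
  "alt_sum N n r k =
    binom_diff n r + (\<Sum>j<N. binom_diff n (r - int (Suc j)) * alt_qbinom q k (Suc j))"
  unfolding alt_sum_def lessThan_Suc_atMost[symmetric] sum.lessThan_Suc_shift by simp

lemma alt_sum_pred:
  assumes "r \<le> int N"
  shows "alt_sum N n (r - 1) k = (\<Sum>j<N. binom_diff n (r - int (Suc j)) * alt_qbinom q k j)"
  unfolding alt_sum_def lessThan_Suc_atMost[symmetric] sum.lessThan_Suc
  using assms by (simp add: diff_diff_eq)

lemma alt_sum_Suc_Pascal:
  assumes "r \<le> int N"
  shows "alt_sum N (Suc n) r k = binom_diff n r +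
    (\<Sum>j<N. binom_diff n (r - int (Suc j)) * (alt_qbinom q k (Suc j) + alt_qbinom q k j))"
proof -
  let ?g = "\<lambda>j. binom_diff n (r - int j) :: 'a"
  have "alt_sum N (Suc n) r k = (\<Sum>j\<le>N. (?g j + 1 * ?g (Suc j)) * alt_qbinom q k j)"
    by (simp add: alt_sum_def binom_diff_Suc diff_diff_eq add.commute)
  also have "\<dots> = ?g 0 * alt_qbinom q k 0 +
      (\<Sum>j<N. ?g (Suc j) * (alt_qbinom q k (Suc j) + 1 * alt_qbinom q k j))"
    by (rule sum_shift_by_parts) (use assms in simp)
  finally show ?thesis by simp
qed

lemma alt_sum_rec:
  assumes "r \<le> int N"
  shows "alt_sum N (Suc n) r (Suc k) =
    alt_sum N n r k + (1 - q ^ Suc (Suc k)) * alt_sum N n (r - 1) (Suc (Suc k))"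
  unfolding alt_sum_Suc_Pascal[OF assms] alt_qbinom_rec alt_sum_head[of N n r k]
    alt_sum_pred[OF assms]
  by (simp add: ring_distribs sum.distrib sum_distrib_left mult_ac del: power_Suc of_nat_Suc)

lemma alt_sum_rec_0:
  assumes "r \<le> int N"
  shows "alt_sum N (Suc n) r 0 = binom_diff n r + (1 - q) * alt_sum N n (r - 1) (Suc 0)"
  unfolding alt_sum_Suc_Pascal[OF assms] alt_qbinom_rec_0 alt_sum_pred[OF assms]
  by (simp add: sum_distrib_left mult_ac del: of_nat_Suc)

text \<open>
  Multiplying by \<open>(1 - q) ^ l\<close> clears the denominators: in the recurrence of \<^const>\<open>c\<close> the geometric
  sum becomes \<open>1 - q ^ (k + 1)\<close>. The bound \<open>N\<close> may be any number that is at least \<open>l\<close>,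
  so that the sums on both sides of the recurrence can share it.
\<close>

lemma c_eq_alt_sum:
  assumes "l \<le> N"
  shows "(1 - q) ^ l * c (k + 2 * l) k q = alt_sum N (k + 2 * l) (int l) k"
proof -
  have "n = k + 2 * l \<Longrightarrow> l \<le> N \<Longrightarrow> (1 - q) ^ l * c n k q = alt_sum N n (int l) k" for n
  proof (induction n arbitrary: k l)
    case 0
    then have "k = 0" "l = 0" by auto
    then show ?case
      by (simp add: c_0_0 alt_sum_head) (simp add: binom_diff_def ibinom_def)
  next
    case (Suc n)
    have geo: "(1 - q) * (\<Sum>i<Suc k. q ^ i) = 1 - q ^ Suc k"
      by (simp only: one_diff_power_eq)
    show ?case
    proof (cases k)
      case 0
      with Suc.prems(1) obtain l' where l: "l = Suc l'" by (cases l) auto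
      then have n: "n = Suc 0 + 2 * l'" using Suc.prems 0 by simp
      have "(1 - q) ^ l * c (Suc n) k q = (1 - q) * ((1 - q) ^ l' * c n (Suc 0) q)"
        by (simp add: c_Suc 0 l)
      also have "(1 - q) ^ l' * c n (Suc 0) q = alt_sum N n (int l') (Suc 0)"
        by (rule Suc.IH[OF n]) (use Suc.prems l in simp)
      \<comment> \<open>The left-over term sits at \<open>l = (n + 1) / 2\<close>, the middle of an odd row.\<close>
      also have "(1 - q) * \<dots> = alt_sum N (Suc n) (int l) k"
        using alt_sum_rec_0[of "int l" N n] Suc.prems(2) binom_diff_middle[of l', where ?'a = 'a]
        by (simp add: 0 l n)
      finally show ?thesis .
    next
      case (Suc k')
      have 1: "(1 - q) ^ l * c n k' q = alt_sum N n (int l) k'"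
        by (rule Suc.IH) (use Suc Suc.prems in auto)
      have 2: "(1 - q) ^ l * ((\<Sum>i<Suc k. q ^ i) * c n (Suc k) q) =
          (1 - q ^ Suc k) * alt_sum N n (int l - 1) (Suc k)"
      proof (cases l)
        case 0
        then have "n < Suc k" using Suc Suc.prems by simp
        then show ?thesis using 0 by (simp add: c_eq_0)
      next
        case l: (Suc l')
        have "(1 - q) ^ l * ((\<Sum>i<Suc k. q ^ i) * c n (Suc k) q) =
            ((1 - q) * (\<Sum>i<Suc k. q ^ i)) * ((1 - q) ^ l' * c n (Suc k) q)"
          unfolding l power_Suc by (simp only: mult_ac)
        also have "(1 - q) ^ l' * c n (Suc k) q = alt_sum N n (int l') (Suc k)"
          by (rule Suc.IH) (use Suc Suc.prems l in auto)
        finally show ?thesis unfolding geo using l by simp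
      qed
      have "(1 - q) ^ l * c (Suc n) k q =
          (1 - q) ^ l * c n k' q + (1 - q) ^ l * ((\<Sum>i<Suc k. q ^ i) * c n (Suc k) q)"
        unfolding c_Suc[of n k] by (simp add: Suc ring_distribs del: sum.lessThan_Suc)
      also have "\<dots> = alt_sum N (Suc n) (int l) k"
        unfolding 1 2 using alt_sum_rec[of "int l" N n k'] Suc.prems(2) by (simp add: Suc)
      finally show ?thesis .
    qed
  qed
  then show ?thesis using assms by blast
qed

text \<open>Summation by parts moves the difference from the binomial coefficients to the other factor.\<close>

lemma alt_sum_by_parts:
  assumes "r \<le> int N"
  shows "alt_sum N n r k = (\<Sum>j\<le>N. of_nat (ibinom n (r - int j)) *
    ((-1) ^ j * q ^ (j choose 2) * qint_ratio q k j * qbinom q (k + j) j))"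
proof -
  let ?g = "\<lambda>j. of_nat (ibinom n (r - int j)) :: 'a"
  let ?t = "\<lambda>j. (-1) ^ j * q ^ (j choose 2) * qint_ratio q k j * qbinom q (k + j) j"
  have "alt_sum N n r k = (\<Sum>j\<le>N. (?g j + (-1) * ?g (Suc j)) * alt_qbinom q k j)"
    by (simp add: alt_sum_def binom_diff_def diff_diff_eq add.commute)
  also have "\<dots> = ?g 0 * alt_qbinom q k 0 +
      (\<Sum>j<N. ?g (Suc j) * (alt_qbinom q k (Suc j) + (-1) * alt_qbinom q k j))"
    by (rule sum_shift_by_parts) (use assms in \<open>simp add: ibinom_def\<close>)
  also have "\<dots> = ?g 0 * alt_qbinom q k 0 + (\<Sum>j<N. ?g (Suc j) * ?t (Suc j))"
    unfolding alt_qbinom_diff by simp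
  also have "alt_qbinom q k 0 = ?t 0"
  proof (cases k)
    case 0
    then show ?thesis by (simp add: qint_ratio_def qbinom_left_0 numeral_2_eq_2)
  next
    case (Suc k')
    then show ?thesis
      using one_minus_power_nonzero[of k'] one_minus_nonzero
      by (simp add: qint_ratio_def qint_def qbinom_left_0 numeral_2_eq_2)
  qed
  also have "?g 0 * ?t 0 + (\<Sum>j<N. ?g (Suc j) * ?t (Suc j)) = (\<Sum>j\<le>N. ?g j * ?t j)"
    unfolding lessThan_Suc_atMost[symmetric] sum.lessThan_Suc_shift ..
  finally show ?thesis .
qed

end

lemma qvar_power_neq_1: "n > 0 \<Longrightarrow> qvar ^ n \<noteq> 1"
proof -
  assume "n > 0"
  have "qvar ^ n = Fract ([:0, 1:] ^ n) 1"
    by (induction n) (simp_all add: qvar_def One_fract_def)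
  moreover have "[:0, 1:] ^ n \<noteq> (1 :: rat poly)"
    using \<open>n > 0\<close> by (metis degree_1 degree_linear_power less_numeral_extra(3))
  ultimately show ?thesis by (simp add: One_fract_def eq_fract)
qed

theorem proposition14:
  fixes n k :: nat
  assumes "k mod 2 = n mod 2"
  shows "c n k qvar =
      (1 - qvar) powi (- ((int n - int k) div 2)) *
      Sum_any (\<lambda>j::nat.
        of_nat (ibinom n ((int n - int k - 2 * int j) div 2)) *
        ((-1) ^ j * qvar ^ (j choose 2) * qint_ratio qvar k j * qbinom qvar (k + j) j))
    \<and> c n k qvar =
      (1 - qvar) powi (- ((int n - int k) div 2)) *
      Sum_any (\<lambda>j::nat.
        (of_nat (ibinom n ((int n - int k - 2 * int j) div 2)) -
         of_nat (ibinom n ((int n - int k - 2 * int j - 2) div 2))) *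
        ((-1) ^ j * qvar ^ ((j + 1) choose 2) * qbinom qvar (k + j) k))"
proof (cases "k \<le> n")
  case False
  then have "c n k qvar = 0" by (simp add: c_eq_0)
  moreover have "ibinom n ((int n - int k - 2 * int j) div 2) = 0"
    "ibinom n ((int n - int k - 2 * int j - 2) div 2) = 0" for j
    using False by (auto simp: ibinom_def)
  ultimately show ?thesis by simp
next
  case True
  interpret not_root_of_unity qvar
    by standard (rule qvar_power_neq_1)
  have "even k \<longleftrightarrow> even n" using assms by (simp add: even_iff_mod_2_eq_zero)
  then have "even (n - k)" by simp
  then obtain l where "n - k = 2 * l" by (rule evenE)
  then have n: "n = k + 2 * l" using True by simp
  have idx: "(int n - int k) div 2 = int l"
    "(int n - int k - 2 * int j) div 2 = int l - int j"
    "(int n - int k - 2 * int j - 2) div 2 = int l - int j - 1" for j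
  proof -
    have "int n - int k = 2 * int l" "int n - int k - 2 * int j = 2 * (int l - int j)"
      "int n - int k - 2 * int j - 2 = 2 * (int l - int j - 1)"
      using n by simp_all
    then show "(int n - int k) div 2 = int l"
      "(int n - int k - 2 * int j) div 2 = int l - int j"
      "(int n - int k - 2 * int j - 2) div 2 = int l - int j - 1"
      by (simp_all only: nonzero_mult_div_cancel_left zero_neq_numeral[symmetric] not_False_eq_True)
  qed
  have c: "c n k qvar = (1 - qvar) powi (- int l) * alt_sum l n (int l) k"
    using c_eq_alt_sum[of l l k] one_minus_nonzero
    by (simp add: n power_int_minus field_simps)
  have 1: "alt_sum l n (int l) k = Sum_any (\<lambda>j. of_nat (ibinom n (int l - int j)) *
      ((-1) ^ j * qvar ^ (j choose 2) * qint_ratio qvar k j * qbinom qvar (k + j) j))"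
    unfolding alt_sum_by_parts[OF order_refl]
    by (rule Sum_any.expand_superset[symmetric]) (auto simp: ibinom_def split: if_splits)
  have 2: "alt_sum l n (int l) k =
      Sum_any (\<lambda>j. (of_nat (ibinom n (int l - int j)) - of_nat (ibinom n (int l - int j - 1))) *
        ((-1) ^ j * qvar ^ ((j + 1) choose 2) * qbinom qvar (k + j) k))"
    unfolding alt_sum_def binom_diff_def alt_qbinom_def
    by (rule Sum_any.expand_superset[symmetric]) (auto simp: ibinom_def split: if_splits)
  show ?thesis unfolding idx using c 1 2 by simp
qed

end
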